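(* For all integers $n\ge1$, $$\mu_{\mathcal{L}(\mathcal{H}_{2n-1})}(\hat0,\hat1)=-g_n,$$ where $\hat 0$ and $\hat 1$ are the minimum and maximum elements of $\mathcal{L}(\mathcal{H}_{2n-1})$, $\mu$ is its Möbius function, and $g_n$ is the $n$-th Genocchi number.
   Context: For $n\ge 1$, the homogenized Linial arrangement $\mathcal{H}_{2n-1}$ is the set of hyperplanes $\{x_i - x_j = y_i\}$, $1 \le i < j \le n+1$, in $\mathbb{R}^{2n+1}$ with coordinates $(x_1,\dots,x_{n+1},y_1,\dots,y_n)$. Its intersection lattice $\mathcal{L}(\mathcal{H}_{2n-1})$ is the set of all intersections of subsets of these hyperplanes (the empty intersection being the whole space), ordered by reverse inclusion. A Dumont permutation on $[2m]=\{1,\dots,2m\}$ is a permutation $\sigma$ of $[2m]$ with $2i>\sigma(2i)$ and $2i-1\le\sigma(2i-1)$ for all $i=1,\dots,m$. For $n\ge1$ the Genocchi number $g_n$ is defined as the number of Dumont permutations on $[2n-2]$ (so $g_1,g_2,\ldots=1,1,3,17,155,\dots$). *)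

theory Defs
  imports Complex_Main "HOL-Library.FuncSet" "HOL-Algebra.Order" "HOL-Combinatorics.Permutations"
begin

section \<open>Moebius function of a locally finite poset\<close>

text \<open>
  The recursion is \<open>\<mu>(x, x) = 1\<close> and \<open>\<mu>(x, y) = - (\<Sum>x \<le> z < y. \<mu>(x, z))\<close>. The side conditions make
  it terminate; wherever they fail (incomparable elements, infinite intervals, records that are
  not partial orders) the value is 0.
\<close>

function mobius :: "('a, 'b) gorder_scheme \<Rightarrow> 'a \<Rightarrow> 'a \<Rightarrow> int" where
  "mobius L x y =
    (if partial_order L \<and> x \<in> carrier L \<and> y \<in> carrier L \<and> x \<sqsubseteq>\<^bsub>L\<^esub> y \<and> finite \<lbrace>x..y\<rbrace>\<^bsub>L\<^esub>
     then if x = y then 1 else - (\<Sum>z\<in>{z \<in> carrier L. x \<sqsubseteq>\<^bsub>L\<^esub> z \<and> z \<sqsubset>\<^bsub>L\<^esub> y}. mobius L x z)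
     else 0)"
  by pat_completeness auto
termination
proof (relation "measure (\<lambda>(L, x, y). card \<lbrace>x..y\<rbrace>\<^bsub>L\<^esub>)", simp, clarify)
  fix L :: "('a, 'b) gorder_scheme" and x y z
  assume "partial_order L" and x: "x \<in> carrier L" and y: "y \<in> carrier L" and xy: "x \<sqsubseteq>\<^bsub>L\<^esub> y"
    and fin: "finite \<lbrace>x..y\<rbrace>\<^bsub>L\<^esub>" and z: "z \<in> carrier L" "x \<sqsubseteq>\<^bsub>L\<^esub> z" "z \<sqsubset>\<^bsub>L\<^esub> y"
  then interpret partial_order L by simp
  have zy: "z \<sqsubseteq>\<^bsub>L\<^esub> y" "z \<noteq> y"
    using z y by (auto simp: lless_def eq_is_equal)
  have "\<lbrace>x..z\<rbrace>\<^bsub>L\<^esub> \<subseteq> \<lbrace>x..y\<rbrace>\<^bsub>L\<^esub>"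
    using zy z y le_trans by (auto simp: at_least_at_most_def)
  moreover have "y \<in> \<lbrace>x..y\<rbrace>\<^bsub>L\<^esub>" "y \<notin> \<lbrace>x..z\<rbrace>\<^bsub>L\<^esub>"
    using zy z y xy le_antisym by (auto simp: at_least_at_most_def)
  ultimately have "card \<lbrace>x..z\<rbrace>\<^bsub>L\<^esub> < card \<lbrace>x..y\<rbrace>\<^bsub>L\<^esub>"
    by (intro psubset_card_mono fin) auto
  then show "((L, x, z), (L, x, y)) \<in> measure (\<lambda>(L, x, y). card \<lbrace>x..y\<rbrace>\<^bsub>L\<^esub>)"
    by simp
qed

declare mobius.simps [simp del]

lemma (in partial_order) mobius_refl:
  assumes "x \<in> carrier L"
  shows "mobius L x x = 1"
proof -
  have "\<lbrace>x..x\<rbrace> \<subseteq> {x}"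
    using assms le_antisym by (auto simp: at_least_at_most_def)
  then have "finite \<lbrace>x..x\<rbrace>"
    by (rule finite_subset) simp
  then show ?thesis
    using assms partial_order_axioms by (subst mobius.simps) simp
qed

lemma (in partial_order) mobius_rec:
  assumes "finite (carrier L)" "x \<in> carrier L" "y \<in> carrier L" "x \<sqsubset> y"
  shows "mobius L x y = - (\<Sum>z\<in>{z \<in> carrier L. x \<sqsubseteq> z \<and> z \<sqsubset> y}. mobius L x z)"
proof -
  have "finite \<lbrace>x..y\<rbrace>"
    using assms(1) by (auto simp: at_least_at_most_def)
  then show ?thesis
    using assms partial_order_axioms
    by (subst mobius.simps) (auto simp: lless_def eq_is_equal)
qed


section \<open>Intersection lattices\<close>

definition intersection_lattice :: "'a set \<Rightarrow> 'a set set \<Rightarrow> 'a set gorder" where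
  "intersection_lattice V A =
    \<lparr>carrier = {V \<inter> \<Inter>B | B. B \<subseteq> A}, eq = (=), le = (\<lambda>X Y. Y \<subseteq> X)\<rparr>"

lemma partial_order_intersection_lattice: "partial_order (intersection_lattice V A)"
  by unfold_locales (auto simp: intersection_lattice_def)

lemma finite_intersection_lattice:
  assumes "finite A"
  shows "finite (carrier (intersection_lattice V A))"
proof -
  have "carrier (intersection_lattice V A) = (\<lambda>B. V \<inter> \<Inter>B) ` Pow A"
    by (auto simp: intersection_lattice_def)
  with assms show ?thesis by simp
qed

lemma bottom_intersection_lattice: "\<bottom>\<^bsub>intersection_lattice V A\<^esub> = V"
proof -
  have l: "least (intersection_lattice V A) V (carrier (intersection_lattice V A))"
    by (auto simp: least_def intersection_lattice_def intro!: exI[of _ "{}"])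
  then show ?thesis
    unfolding bottom_def
    by (rule some_equality)
       (use l in \<open>auto simp: least_def intersection_lattice_def\<close>)
qed

lemma top_intersection_lattice: "\<top>\<^bsub>intersection_lattice V A\<^esub> = V \<inter> \<Inter>A"
proof -
  have g: "greatest (intersection_lattice V A) (V \<inter> \<Inter>A) (carrier (intersection_lattice V A))"
    by (auto simp: greatest_def intersection_lattice_def)
  show ?thesis
    unfolding top_def
  proof (rule some_equality[where P = "\<lambda>x. greatest _ x _", OF g])
    fix X assume "greatest (intersection_lattice V A) X (carrier (intersection_lattice V A))"
    then have X: "X \<in> carrier (intersection_lattice V A)"
      and "le (intersection_lattice V A) (V \<inter> \<Inter>A) X"
      using g unfolding greatest_def by blast+
    then have "X \<subseteq> V \<inter> \<Inter>A"
      by (simp add: intersection_lattice_def)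
    moreover obtain B where "B \<subseteq> A" "X = V \<inter> \<Inter>B"
      using X by (auto simp: intersection_lattice_def)
    ultimately show "X = V \<inter> \<Inter>A"
      by blast
  qed
qed


section \<open>The homogenized Linial arrangement\<close>

text \<open>
  A point of \<open>\<real>\<^sup>2\<^sup>n\<^sup>+\<^sup>1\<close> with coordinates \<open>x\<^sub>1, \<dots>, x\<^sub>n\<^sub>+\<^sub>1, y\<^sub>1, \<dots>, y\<^sub>n\<close> is a pair of functions
  restricted to the index ranges (with value \<open>undefined\<close> outside them).
\<close>

definition linial_space :: "nat \<Rightarrow> ((nat \<Rightarrow> real) \<times> (nat \<Rightarrow> real)) set" where
  "linial_space n = ({1..n + 1} \<rightarrow>\<^sub>E UNIV) \<times> ({1..n} \<rightarrow>\<^sub>E UNIV)"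

text \<open>The argument \<open>n\<close> corresponds to \<open>\<H>\<^sub>2\<^sub>n\<^sub>-\<^sub>1\<close>.\<close>

definition homogenized_linial :: "nat \<Rightarrow> ((nat \<Rightarrow> real) \<times> (nat \<Rightarrow> real)) set set" where
  "homogenized_linial n =
    {{(x, y) \<in> linial_space n. x i - x j = y i} | i j. 1 \<le> i \<and> i < j \<and> j \<le> n + 1}"

definition linial_lattice :: "nat \<Rightarrow> ((nat \<Rightarrow> real) \<times> (nat \<Rightarrow> real)) set gorder" where
  "linial_lattice n = intersection_lattice (linial_space n) (homogenized_linial n)"

lemma finite_homogenized_linial: "finite (homogenized_linial n)"
proof -
  have "homogenized_linial n \<subseteq>
      (\<lambda>(i, j). {(x, y) \<in> linial_space n. x i - x j = y i}) ` ({..n + 1} \<times> {..n + 1})"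
    by (force simp: homogenized_linial_def)
  then show ?thesis
    by (rule finite_subset) simp
qed


section \<open>Dumont permutations and Genocchi numbers\<close>

definition dumont_permutation :: "nat \<Rightarrow> (nat \<Rightarrow> nat) \<Rightarrow> bool" where
  "dumont_permutation m \<sigma> \<longleftrightarrow> \<sigma> permutes {1..2 * m} \<and>
    (\<forall>i\<in>{1..m}. 2 * i > \<sigma> (2 * i) \<and> 2 * i - 1 \<le> \<sigma> (2 * i - 1))"

text \<open>Meaningful for \<open>n \<ge> 1\<close>; the permutations act on \<open>[2n - 2] = [2(n - 1)]\<close>.\<close>

definition genocchi :: "nat \<Rightarrow> nat" where
  "genocchi n = card {\<sigma>. dumont_permutation (n - 1) \<sigma>}"

end

theory Submission
  imports Defs "HOL-Number_Theory.Cong"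
begin

text \<open>
  By the cross-cut formula, the Moebius invariant is the signed sum of \<open>(- 1) ^ card B\<close> over the sets \<open>B\<close>
  of hyperplanes that cut out \<open>\<top>\<close>. After the substitution \<open>z\<^sub>i = x\<^sub>i - y\<^sub>i\<close> these are the connected
  spanning subgraphs of a staircase-shaped bipartite graph. Modulo \<open>q\<close>, the signed sum is the number
  of proper \<open>q\<close>-colourings of this graph with a fixed colour at one vertex, since the contribution of
  a disconnected \<open>B\<close> is divisible by \<open>q\<close>. Choosing the colours of the \<open>z\<^sub>i\<close> one at a time and recording
  the number \<open>k\<close> of colours used so far yields, modulo \<open>q\<close>, the Gandhi recursion
  \<open>G\<^sub>r\<^sub>+\<^sub>1(k) = k\<^sup>2 (G\<^sub>r(k + 1) - G\<^sub>r(k))\<close>, \<open>G\<^sub>0(k) = k\<close>, and the value \<open>- G\<^sub>n\<^sub>-\<^sub>1(1)\<close>. As \<open>q\<close> is arbitrary,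
  the congruence is an equality.

  For Dumont permutations, inclusion-exclusion over the violated conditions \<open>2i - 1 \<le> \<sigma>(2i - 1)\<close>
  leaves permutations with upper bounds \<open>\<sigma>(p) < p\<close> on a set of positions, which are counted greedily.
  Recording the number of positions without a bound gives the same recursion.
\<close>

section \<open>Signed sums over subsets\<close>

text \<open>The sum is the expansion of the product of \<open>1 - 1\<close> over
  \<open>S\<close>.\<close>

lemma sum_Pow_alternating:
  assumes "finite S"
  shows "(\<Sum>B\<in>Pow S. (- 1) ^ card B) = (if S = {} then 1 else 0 :: int)"
  using prod_diff_conv_sum[OF assms, of "\<lambda>_. 1 :: int" "\<lambda>_. 1"] assms
  by (cases "S = {}") (simp_all add: power_0_left)

lemma sum_Pow_insert:
  assumes "finite S" "a \<notin> S"
  shows "(\<Sum>B\<in>Pow (insert a S). f B) = (\<Sum>B\<in>Pow S. f B + f (insert a B) :: int)"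
proof -
  have "inj_on (insert a) (Pow S)"
    using assms by (auto simp: inj_on_def)
  moreover have "Pow S \<inter> insert a ` Pow S = {}"
    using assms by auto
  ultimately show ?thesis
    using assms by (simp add: Pow_insert sum.union_disjoint sum.reindex sum.distrib)
qed

text \<open>After exchanging the sums, each \<open>c\<close> contributes the alternating sum over
  the subsets of \<open>{e \<in> E. R c e}\<close>, which is 1 if that set is empty and 0
  otherwise.\<close>

lemma card_avoiding_inclusion_exclusion:
  assumes "finite C" "finite E"
  shows "int (card {c \<in> C. \<forall>e\<in>E. \<not> R c e}) =
    (\<Sum>B\<in>Pow E. (- 1) ^ card B * int (card {c \<in> C. \<forall>e\<in>B. R c e}))"
proof -
  have "(\<Sum>B\<in>Pow E. (- 1) ^ card B * int (card {c \<in> C. \<forall>e\<in>B. R c e})) =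
      (\<Sum>B\<in>Pow E. \<Sum>c | c \<in> C \<and> (\<forall>e\<in>B. R c e). (- 1) ^ card B)"
    by (simp add: mult.commute)
  also have "\<dots> = (\<Sum>c\<in>C. \<Sum>B | B \<in> Pow E \<and> (\<forall>e\<in>B. R c e). (- 1) ^ card B)"
    using assms by (intro sum.swap_restrict) auto
  also have "\<dots> = (\<Sum>c\<in>C. \<Sum>B\<in>Pow {e \<in> E. R c e}. (- 1) ^ card B)"
    by (intro sum.cong) auto
  also have "\<dots> = (\<Sum>c\<in>C. if {e \<in> E. R c e} = {} then 1 else 0)"
    using assms by (intro sum.cong refl sum_Pow_alternating) auto
  also have "\<dots> = int (card {c \<in> C. {e \<in> E. R c e} = {}})"
    using assms by (simp add: sum.If_cases Int_def)
  also have "{c \<in> C. {e \<in> E. R c e} = {}} = {c \<in> C. \<forall>e\<in>E. \<not> R c e}"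
    by auto
  finally show ?thesis ..
qed

text \<open>By Moebius inversion it suffices that the signed number of \<open>B\<close> whose flat contains \<open>X\<close>
  vanishes for \<open>X \<noteq> V\<close>: these \<open>B\<close> are the subsets of a nonempty set.\<close>

lemma mobius_intersection_lattice:
  assumes fin: "finite E" and proper: "\<And>e. e \<in> E \<Longrightarrow> \<not> V \<subseteq> h e"
    and X: "X \<in> carrier (intersection_lattice V (h ` E))"
  shows "mobius (intersection_lattice V (h ` E)) V X =
    (\<Sum>B | B \<subseteq> E \<and> V \<inter> \<Inter>(h ` B) = X. (- 1) ^ card B)"
  using X
proof (induction "card {e \<in> E. X \<subseteq> h e}" arbitrary: X rule: less_induct)
  case less
  let ?L = "intersection_lattice V (h ` E)"
  interpret partial_order ?L
    by (rule partial_order_intersection_lattice)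
  define flat where "flat B = V \<inter> \<Inter>(h ` B)" for B
  have carrier: "carrier ?L = flat ` Pow E"
    unfolding intersection_lattice_def flat_def
    by (auto simp: image_iff subset_image_iff)
  have finL: "finite (carrier ?L)"
    using fin by (simp add: carrier)
  have V: "V \<in> carrier ?L"
    unfolding carrier using flat_def by (auto intro!: image_eqI[of _ _ "{}"])
  \<comment> \<open>A flat is recovered from the set of all hyperplanes containing it, so this set
    shrinks strictly as the flat grows. Its size is the induction measure.\<close>
  have X: "X \<subseteq> V" "X = flat {e \<in> E. X \<subseteq> h e}"
    using less.prems unfolding carrier by (auto simp: flat_def)
  show ?case
  proof (cases "X = V")
    case True
    then have "{B. B \<subseteq> E \<and> V \<inter> \<Inter>(h ` B) = X} = {{}}"
      using proper by auto
    then show ?thesis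
      using True V mobius_refl by simp
  next
    case False
    let ?s = "\<lambda>B. (- 1) ^ card B :: int"
    have "{e \<in> E. X \<subseteq> h e} \<noteq> {}"
      using False X(2) by (auto simp: flat_def)
    then have "(\<Sum>B\<in>Pow {e \<in> E. X \<subseteq> h e}. ?s B) = 0"
      using fin by (simp add: sum_Pow_alternating)
    \<comment> \<open>These are the \<open>B\<close> whose flat contains \<open>X\<close>, split
      according to whether the containment is strict.\<close>
    also have "Pow {e \<in> E. X \<subseteq> h e} = {B. B \<subseteq> E \<and> X \<subset> flat B} \<union> {B. B \<subseteq> E \<and> flat B = X}"
      using X(1) by (auto simp: flat_def)
    finally have *: "(\<Sum>B | B \<subseteq> E \<and> X \<subset> flat B. ?s B) + (\<Sum>B | B \<subseteq> E \<and> flat B = X. ?s B) = 0"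
      using fin by (subst (asm) sum.union_disjoint) auto
    have "mobius ?L V X = - (\<Sum>Z | Z \<in> carrier ?L \<and> X \<subset> Z. mobius ?L V Z)"
      using False X(1) less.prems V finL
      by (subst mobius_rec)
         (auto simp: intersection_lattice_def lless_def intro!: sum.cong)
    also have "(\<Sum>Z | Z \<in> carrier ?L \<and> X \<subset> Z. mobius ?L V Z) =
        (\<Sum>Z | Z \<in> carrier ?L \<and> X \<subset> Z. \<Sum>B | B \<in> {B. B \<subseteq> E \<and> X \<subset> flat B} \<and> flat B = Z. ?s B)"
    proof (intro sum.cong HOL.refl)
      fix Z assume Z: "Z \<in> {Z. Z \<in> carrier ?L \<and> X \<subset> Z}"
      then obtain D where D: "D \<subseteq> E" "Z = flat D"
        by (auto simp: carrier)
      have "{e \<in> E. Z \<subseteq> h e} \<subset> {e \<in> E. X \<subseteq> h e}"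
      proof -
        have "{e \<in> E. Z \<subseteq> h e} \<noteq> {e \<in> E. X \<subseteq> h e}"
        proof
          assume eq: "{e \<in> E. Z \<subseteq> h e} = {e \<in> E. X \<subseteq> h e}"
          have "Z \<subseteq> flat {e \<in> E. Z \<subseteq> h e}"
            using D by (auto simp: flat_def)
          then show False
            using eq X(2) Z by auto
        qed
        then show ?thesis
          using Z by blast
      qed
      then have "mobius ?L V Z = (\<Sum>B | B \<subseteq> E \<and> V \<inter> \<Inter>(h ` B) = Z. ?s B)"
        using Z fin by (intro less.hyps psubset_card_mono) auto
      moreover have "{B. B \<subseteq> E \<and> V \<inter> \<Inter>(h ` B) = Z} =
          {B. B \<in> {B. B \<subseteq> E \<and> X \<subset> flat B} \<and> flat B = Z}"
        using Z by (auto simp: flat_def)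
      ultimately show "mobius ?L V Z =
          (\<Sum>B | B \<in> {B. B \<subseteq> E \<and> X \<subset> flat B} \<and> flat B = Z. ?s B)"
        by simp
    qed
    also have "\<dots> = (\<Sum>B | B \<subseteq> E \<and> X \<subset> flat B. ?s B)"
      using fin finL by (intro sum.group) (auto simp: carrier)
    finally show ?thesis
      using * by (simp add: flat_def)
  qed
qed


section \<open>Gandhi polynomials\<close>

text \<open>Starting at \<open>k\<close>, one step before the more usual \<open>k ^ 2\<close>, makes
  \<open>gandhi m 1\<close> run through 1, 1, 3, 17 from \<open>m = 0\<close> on.\<close>

primrec gandhi :: "nat \<Rightarrow> nat \<Rightarrow> int" where
  "gandhi 0 k = int k"
| "gandhi (Suc r) k = int k ^ 2 * (gandhi r (Suc k) - gandhi r k)"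

lemma gandhi_0_right [simp]: "gandhi r 0 = 0"
  by (cases r) auto


section \<open>Dumont permutations\<close>

text \<open>Members of \<open>Pi\<^sub>E Q A\<close> are \<open>undefined\<close> at
  \<open>p\<close>, so overwriting that value loses nothing.\<close>

lemma inj_on_fun_upd_PiE:
  assumes "p \<notin> Q"
  shows "inj_on (\<lambda>(\<sigma>, t). \<sigma>(p := t)) (Pi\<^sub>E Q A \<times> UNIV)"
proof (rule inj_onI, clarify)
  fix \<sigma> \<tau> s t
  assume PiE: "\<sigma> \<in> Pi\<^sub>E Q A" "\<tau> \<in> Pi\<^sub>E Q A" and eq: "\<sigma>(p := s) = \<tau>(p := t)"
  have "\<sigma> r = \<tau> r" for r
    using fun_cong[OF eq, of r] PiE_arb[OF PiE(1) assms] PiE_arb[OF PiE(2) assms]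
    by (cases "r = p") simp_all
  then show "\<sigma> = \<tau> \<and> s = t"
    using fun_cong[OF eq, of p] by auto
qed

text \<open>Increasing the domain beyond \<open>Q\<close> by a point whose bound contains all previous ones leaves
  exactly \<open>card (A p) - card Q\<close> choices there.\<close>

lemma card_inj_PiE_insert:
  assumes "finite Q" "p \<notin> Q" "\<And>r. r \<in> Q \<Longrightarrow> A r \<subseteq> A p" "finite (A p)"
  shows "card {\<sigma> \<in> Pi\<^sub>E (insert p Q) A. inj_on \<sigma> (insert p Q)} =
    (card (A p) - card Q) * card {\<sigma> \<in> Pi\<^sub>E Q A. inj_on \<sigma> Q}"
proof -
  let ?J = "{\<sigma> \<in> Pi\<^sub>E Q A. inj_on \<sigma> Q}"
  let ?f = "\<lambda>(\<sigma>, t). \<sigma>(p := t)"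
  have finJ: "finite ?J"
  proof -
    have "finite (Pi\<^sub>E Q A)"
      using assms by (intro finite_PiE) (auto dest: finite_subset)
    then show ?thesis
      by (rule rev_finite_subset) auto
  qed
  have upd: "(\<sigma>(p := t)) ` Q = \<sigma> ` Q" "inj_on (\<sigma>(p := t)) Q \<longleftrightarrow> inj_on \<sigma> Q"
    for \<sigma> :: "'a \<Rightarrow> 'b" and t
    using \<open>p \<notin> Q\<close> by (auto simp: inj_on_def)
  have "inj_on ?f (SIGMA \<sigma>:?J. A p - \<sigma> ` Q)"
    by (rule inj_on_subset[OF inj_on_fun_upd_PiE[OF \<open>p \<notin> Q\<close>]]) blast
  moreover have "?f ` (SIGMA \<sigma>:?J. A p - \<sigma> ` Q) =
      {\<sigma> \<in> Pi\<^sub>E (insert p Q) A. inj_on \<sigma> (insert p Q)}" (is "?l = ?r")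
  proof
    show "?l \<subseteq> ?r"
    proof clarify
      fix \<sigma> t assume \<sigma>: "\<sigma> \<in> Pi\<^sub>E Q A" "inj_on \<sigma> Q" and t: "t \<in> A p" "t \<notin> \<sigma> ` Q"
      have "\<sigma>(p := t) \<in> Pi\<^sub>E (insert p Q) A"
        using t(1) \<sigma>(1) by (rule PiE_fun_upd)
      moreover have "inj_on (\<sigma>(p := t)) (insert p Q)"
        using \<open>p \<notin> Q\<close> \<sigma>(2) t(2) by (simp only: inj_on_insert upd fun_upd_same Diff_insert0 Diff_empty simp_thms)
      ultimately show "\<sigma>(p := t) \<in> Pi\<^sub>E (insert p Q) A \<and> inj_on (\<sigma>(p := t)) (insert p Q)"
        by blast
    qed
    show "?r \<subseteq> ?l"
    proof
      fix \<tau> assume \<tau>: "\<tau> \<in> ?r"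
      \<comment> \<open>Resetting the value at \<open>p\<close> recovers the function on
        \<open>Q\<close> that \<open>\<tau>\<close> extends.\<close>
      then have "\<tau>(p := undefined) \<in> Pi\<^sub>E Q A"
        using \<open>p \<notin> Q\<close> by (intro fun_upd_in_PiE) simp_all
      moreover have "inj_on \<tau> Q" "\<tau> p \<in> A p - \<tau> ` Q"
        using \<tau> \<open>p \<notin> Q\<close> by auto
      ultimately have "\<tau>(p := undefined) \<in> ?J" "\<tau> p \<in> A p - (\<tau>(p := undefined)) ` Q"
        by (simp_all only: upd mem_Collect_eq simp_thms)
      then have "?f (\<tau>(p := undefined), \<tau> p) \<in> ?l"
        by (intro imageI SigmaI)
      then show "\<tau> \<in> ?l"
        by simp
    qed
  qed
  ultimately have "bij_betw ?f (SIGMA \<sigma>:?J. A p - \<sigma> ` Q)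
      {\<sigma> \<in> Pi\<^sub>E (insert p Q) A. inj_on \<sigma> (insert p Q)}"
    by (rule bij_betw_imageI)
  then have "card {\<sigma> \<in> Pi\<^sub>E (insert p Q) A. inj_on \<sigma> (insert p Q)} =
      card (SIGMA \<sigma>:?J. A p - \<sigma> ` Q)"
    by (rule bij_betw_same_card[symmetric])
  also have "\<dots> = (\<Sum>\<sigma>\<in>?J. card (A p - \<sigma> ` Q))"
    using finJ \<open>finite (A p)\<close> by (intro card_SigmaI) auto
  also have "\<dots> = (\<Sum>\<sigma>\<in>?J. card (A p) - card Q)"
  proof (rule sum.cong)
    fix \<sigma> assume \<sigma>: "\<sigma> \<in> ?J"
    then have "\<sigma> ` Q \<subseteq> A p"
      using assms(3) by (blast dest: PiE_mem)
    moreover have "card (\<sigma> ` Q) = card Q"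
      using \<sigma> by (simp add: card_image)
    ultimately show "card (A p - \<sigma> ` Q) = card (A p) - card Q"
      using assms by (simp add: card_Diff_subset)
  qed simp
  finally show ?thesis
    by (simp add: mult.commute)
qed

text \<open>These are the restrictions to \<open>Q\<close> of permutations with
  \<open>\<sigma> p < p\<close> on \<open>Q\<close>. The bounds depend on \<open>p\<close> alone, so
  the size of the ground set does not enter.\<close>

definition descending_injections :: "nat set \<Rightarrow> (nat \<Rightarrow> nat) set" where
  "descending_injections Q = {\<sigma> \<in> Pi\<^sub>E Q (\<lambda>p. {1..<p}). inj_on \<sigma> Q}"

text \<open>As \<open>p\<close> lies above all of \<open>Q\<close>, its \<open>p - 1\<close>
  admissible values include every value already taken.\<close>

lemma card_descending_injections_insert:
  assumes "finite Q" "\<And>r. r \<in> Q \<Longrightarrow> r < p"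
  shows "card (descending_injections (insert p Q)) =
    (p - 1 - card Q) * card (descending_injections Q)"
  unfolding descending_injections_def
  using assms by (subst card_inj_PiE_insert) (auto dest: less_imp_le)

lemma card_permutations_descending:
  fixes N :: nat
  assumes "Q \<subseteq> {1..N}"
  shows "card {\<sigma>. \<sigma> permutes {1..N} \<and> (\<forall>p\<in>Q. \<sigma> p < p)} =
    card (descending_injections Q) * fact (N - card Q)"
proof -
  define A where "A p = (if p \<in> Q then {1..<p} else {1..N})" for p
  have finQ: "finite Q"
    using assms finite_subset by blast
  \<comment> \<open>\<open>R\<close> collects the unbounded positions filled so far. Each new one
    contributes the leading factor of the remaining factorial, so the product stays
    constant.\<close>
  have fill: "card {\<sigma> \<in> Pi\<^sub>E (R \<union> Q) A. inj_on \<sigma> (R \<union> Q)} * fact (N - card (R \<union> Q)) =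
      card (descending_injections Q) * fact (N - card Q)"
    if "finite R" "R \<subseteq> {1..N} - Q" for R
    using that
  proof (induction R rule: finite_induct)
    case empty
    have "Pi\<^sub>E Q A = Pi\<^sub>E Q (\<lambda>p. {1..<p})"
      by (intro PiE_cong) (simp add: A_def)
    then show ?case
      by (simp add: descending_injections_def)
  next
    case (insert p R)
    have "card {\<sigma> \<in> Pi\<^sub>E (insert p (R \<union> Q)) A. inj_on \<sigma> (insert p (R \<union> Q))} =
        (N - card (R \<union> Q)) * card {\<sigma> \<in> Pi\<^sub>E (R \<union> Q) A. inj_on \<sigma> (R \<union> Q)}"
      using insert finQ assms by (subst card_inj_PiE_insert) (fastforce simp: A_def)+
    moreover have "card (insert p (R \<union> Q)) = Suc (card (R \<union> Q))"
      using insert finQ by auto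
    moreover have "card (insert p (R \<union> Q)) \<le> card {1..N}"
      using insert.prems assms by (intro card_mono) auto
    then have "fact (N - card (R \<union> Q)) =
        (N - card (R \<union> Q)) * fact (N - card (insert p (R \<union> Q)))"
      using \<open>card (insert p (R \<union> Q)) = _\<close> by (subst fact_reduce) auto
    ultimately show ?case
      using insert by (simp add: mult_ac)
  qed
  have "({1..N} - Q) \<union> Q = {1..N}"
    using assms by auto
  then have "card {\<sigma> \<in> Pi\<^sub>E {1..N} A. inj_on \<sigma> {1..N}} =
      card (descending_injections Q) * fact (N - card Q)"
    using fill[of "{1..N} - Q"] by simp
  moreover have "bij_betw (\<lambda>\<sigma>. restrict \<sigma> {1..N})
      {\<sigma>. \<sigma> permutes {1..N} \<and> (\<forall>p\<in>Q. \<sigma> p < p)} {\<sigma> \<in> Pi\<^sub>E {1..N} A. inj_on \<sigma> {1..N}}"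
  \<comment> \<open>Outside \<open>{1..N}\<close> permutations are the identity and extensional
    functions are \<open>undefined\<close>; the two maps exchange these conventions.\<close>
  proof (rule bij_betw_byWitness[where f' = "\<lambda>\<tau> p. if p \<in> {1..N} then \<tau> p else p"])
    show "\<forall>\<sigma>\<in>{\<sigma>. \<sigma> permutes {1..N} \<and> (\<forall>p\<in>Q. \<sigma> p < p)}.
        (\<lambda>p. if p \<in> {1..N} then restrict \<sigma> {1..N} p else p) = \<sigma>"
      by (auto simp: fun_eq_iff permutes_def)
    show "\<forall>\<tau>\<in>{\<sigma> \<in> Pi\<^sub>E {1..N} A. inj_on \<sigma> {1..N}}.
        restrict (\<lambda>p. if p \<in> {1..N} then \<tau> p else p) {1..N} = \<tau>"
      by (auto simp: fun_eq_iff PiE_iff extensional_def)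
    show "(\<lambda>\<sigma>. restrict \<sigma> {1..N}) ` {\<sigma>. \<sigma> permutes {1..N} \<and> (\<forall>p\<in>Q. \<sigma> p < p)} \<subseteq>
        {\<sigma> \<in> Pi\<^sub>E {1..N} A. inj_on \<sigma> {1..N}}"
    proof clarify
      fix \<sigma> assume \<sigma>: "\<sigma> permutes {1..N}" "\<forall>p\<in>Q. \<sigma> p < p"
      then have "\<sigma> p \<in> {1..N}" if "p \<in> {1..N}" for p
        using that permutes_in_image by metis
      then show "restrict \<sigma> {1..N} \<in> Pi\<^sub>E {1..N} A \<and> inj_on (restrict \<sigma> {1..N}) {1..N}"
        using \<sigma> permutes_inj_on[OF \<sigma>(1)] by (auto simp: A_def)
    qed
    show "(\<lambda>\<tau> p. if p \<in> {1..N} then \<tau> p else p) ` {\<sigma> \<in> Pi\<^sub>E {1..N} A. inj_on \<sigma> {1..N}} \<subseteq>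
        {\<sigma>. \<sigma> permutes {1..N} \<and> (\<forall>p\<in>Q. \<sigma> p < p)}"
    proof clarify
      fix \<tau> assume \<tau>: "\<tau> \<in> Pi\<^sub>E {1..N} A" "inj_on \<tau> {1..N}"
      let ?\<sigma> = "\<lambda>p. if p \<in> {1..N} then \<tau> p else p"
      have "A p \<subseteq> {1..N}" if "p \<in> {1..N}" for p
        using that by (auto simp: A_def)
      then have "\<tau> ` {1..N} \<subseteq> {1..N}"
        using \<tau>(1) by blast
      moreover have "inj_on ?\<sigma> {1..N} \<longleftrightarrow> inj_on \<tau> {1..N}"
        by (rule inj_on_cong) simp
      ultimately have "?\<sigma> permutes {1..N}"
        using \<tau>(2) by (intro inj_imp_permutes) (auto simp: image_subset_iff)
      moreover have "?\<sigma> p < p" if "p \<in> Q" for p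
        using that assms PiE_mem[OF \<tau>(1), of p] by (simp add: A_def subset_iff)
      ultimately show "?\<sigma> permutes {1..N} \<and> (\<forall>p\<in>Q. ?\<sigma> p < p)"
        by blast
    qed
  qed
  ultimately show ?thesis
    by (simp add: bij_betw_same_card)
qed

section \<open>The signed count of Dumont permutations\<close>

definition odds_upto :: "nat \<Rightarrow> nat set" where
  "odds_upto m = {p \<in> {1..2 * m}. odd p}"

definition evens_upto :: "nat \<Rightarrow> nat set" where
  "evens_upto m = {p \<in> {1..2 * m}. even p}"

lemma odds_upto_Suc: "odds_upto (Suc m) = insert (2 * m + 1) (odds_upto m)"
  by (auto simp: odds_upto_def elim!: oddE)

lemma evens_upto_Suc: "evens_upto (Suc m) = insert (2 * m + 2) (evens_upto m)"
  by (auto simp: evens_upto_def elim!: evenE)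

lemma card_evens_upto: "card (evens_upto m) = m"
proof (induction m)
  case (Suc m)
  have "2 * m + 2 \<notin> evens_upto m" "finite (evens_upto m)"
    by (auto simp: evens_upto_def)
  then show ?case
    using Suc by (simp add: evens_upto_Suc)
qed (simp add: evens_upto_def)

lemma card_odds_upto: "card (odds_upto m) = m"
proof (induction m)
  case (Suc m)
  have "2 * m + 1 \<notin> odds_upto m" "finite (odds_upto m)"
    by (auto simp: odds_upto_def)
  then show ?case
    using Suc by (simp add: odds_upto_Suc)
qed (simp add: odds_upto_def)

text \<open>Induction on \<open>m\<close> removes the two largest positions \<open>2 * m + 1\<close>
  and \<open>2 * m + 2\<close>. Summing over whether the odd one belongs to \<open>S\<close>
  performs one step of the Gandhi recursion, so \<open>r\<close> grows as \<open>m\<close> falls and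
  must be arbitrary.\<close>

lemma signed_descending_sum:
  "(\<Sum>S\<in>Pow (odds_upto m). (- 1) ^ card S * int (card (descending_injections (S \<union> evens_upto m))) *
      (fact (m - card S) * (gandhi r (Suc (m - card S)) - gandhi r (m - card S)))) =
    gandhi (m + r) 1"
proof (induction m arbitrary: r)
  case 0
  \<comment> \<open>Only \<open>S = {}\<close> remains, and its term is
    \<open>gandhi r 1 - gandhi r 0\<close> with \<open>gandhi r 0 = 0\<close>.\<close>
  have "descending_injections {} = {\<lambda>_. undefined}"
    by (auto simp: descending_injections_def)
  then show ?case
    by (simp add: odds_upto_def evens_upto_def)
next
  case (Suc m)
  let ?w = "\<lambda>Q. int (card (descending_injections Q))"
  have *: "(- 1) ^ card S * ?w (S \<union> evens_upto (Suc m)) *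
        (fact (Suc m - card S) * (gandhi r (Suc (Suc m - card S)) - gandhi r (Suc m - card S))) +
      (- 1) ^ card (insert (2 * m + 1) S) * ?w (insert (2 * m + 1) S \<union> evens_upto (Suc m)) *
        (fact (Suc m - card (insert (2 * m + 1) S)) *
          (gandhi r (Suc (Suc m - card (insert (2 * m + 1) S))) -
           gandhi r (Suc m - card (insert (2 * m + 1) S)))) =
      (- 1) ^ card S * ?w (S \<union> evens_upto m) *
        (fact (m - card S) * (gandhi (Suc r) (Suc (m - card S)) - gandhi (Suc r) (m - card S)))"
    if S: "S \<in> Pow (odds_upto m)" for S
  proof -
    let ?Q = "S \<union> evens_upto m"
    have Q: "?Q \<subseteq> {1..2 * m}" "finite ?Q" "finite S" "S \<inter> evens_upto m = {}"
      using S by (auto simp: odds_upto_def evens_upto_def intro: finite_subset)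
    have "card S \<le> m"
      using S card_mono[of "odds_upto m" S] by (simp add: card_odds_upto) (simp add: odds_upto_def)
    \<comment> \<open>\<open>f\<close> is the number of positions in \<open>{1..2 * m}\<close>
      without a bound.\<close>
    then obtain f where f: "m = card S + f"
      using le_Suc_ex by blast
    have cardQ: "card ?Q = card S + m"
      using Q by (simp add: card_Un_disjoint card_evens_upto)
    have lt: "q < 2 * m + 1" if "q \<in> ?Q" for q
      using that Q by fastforce
    have 1: "?w (S \<union> evens_upto (Suc m)) = (int f + 1) * ?w ?Q"
    proof -
      have eq: "S \<union> evens_upto (Suc m) = insert (2 * m + 2) ?Q"
        by (auto simp: evens_upto_Suc)
      have "card (descending_injections (insert (2 * m + 2) ?Q)) =
          (2 * m + 1 - card ?Q) * card (descending_injections ?Q)"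
        using Q lt by (subst card_descending_injections_insert) (fastforce simp: less_Suc_eq)+
      then show ?thesis
        unfolding eq using f cardQ by (simp add: algebra_simps)
    qed
    have 2: "?w (insert (2 * m + 1) S \<union> evens_upto (Suc m)) = int f ^ 2 * ?w ?Q"
    proof -
      have eq: "insert (2 * m + 1) S \<union> evens_upto (Suc m) = insert (2 * m + 2) (insert (2 * m + 1) ?Q)"
        by (auto simp: evens_upto_Suc)
      have "card (insert (2 * m + 1) ?Q) = Suc (card ?Q)"
        using Q lt by (intro card_insert_disjoint) auto
      moreover have "card (descending_injections (insert (2 * m + 1) ?Q)) =
          (2 * m - card ?Q) * card (descending_injections ?Q)"
        using Q lt by (subst card_descending_injections_insert) auto
      moreover have "card (descending_injections (insert (2 * m + 2) (insert (2 * m + 1) ?Q))) =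
          (2 * m + 1 - card (insert (2 * m + 1) ?Q)) *
            card (descending_injections (insert (2 * m + 1) ?Q))"
        using Q lt by (subst card_descending_injections_insert) (fastforce simp: less_Suc_eq)+
      ultimately show ?thesis
        unfolding eq using f cardQ by (simp add: power2_eq_square)
    qed
    have 3: "card (insert (2 * m + 1) S) = Suc (card S)"
      using Q lt by (intro card_insert_disjoint) auto
    have 4: "Suc m - card S = Suc f" "m - card S = f" "Suc m - Suc (card S) = f"
      using f by auto
    \<comment> \<open>With \<open>fact f\<close> factored out, the two terms have coefficients
      \<open>(f + 1) ^ 2\<close> and \<open>- (f ^ 2)\<close>, which give
      \<open>gandhi (Suc r)\<close> at \<open>f + 1\<close> minus its value at
      \<open>f\<close>.\<close>
    show ?thesis
      unfolding 1 2 3 4 by (simp add: algebra_simps power2_eq_square)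
  qed
  have fin: "finite (odds_upto m)" and notin: "2 * m + 1 \<notin> odds_upto m"
    by (auto simp: odds_upto_def)
  have shift: "Suc m + r = m + Suc r"
    by simp
  show ?case
    unfolding odds_upto_Suc sum_Pow_insert[OF fin notin] shift
    by (rule trans[OF sum.cong[OF refl *] Suc.IH])
qed

text \<open>The even conditions stay in \<open>C\<close>. A violated odd condition also has the form
  \<open>\<sigma> p < p\<close>, so every term of the inclusion-exclusion counts permutations with
  descending bounds.\<close>

lemma genocchi_eq_gandhi: "int (genocchi (Suc m)) = gandhi m 1"
proof -
  define C where "C = {\<sigma>. \<sigma> permutes {1..2 * m} \<and> (\<forall>p\<in>evens_upto m. \<sigma> p < p)}"
  have "finite C"
    unfolding C_def by (rule rev_finite_subset[OF finite_permutations[of "{1..2 * m}"]]) auto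
  have fin: "finite (odds_upto m)"
    by (simp add: odds_upto_def)
  have evens: "(\<forall>p\<in>evens_upto m. P p) \<longleftrightarrow> (\<forall>i\<in>{1..m}. P (2 * i))" for P
    by (force simp: evens_upto_def elim!: evenE)
  have odds: "(\<forall>p\<in>odds_upto m. P p) \<longleftrightarrow> (\<forall>i\<in>{1..m}. P (2 * i - 1))" for P
  proof
    assume P: "\<forall>i\<in>{1..m}. P (2 * i - 1)"
    show "\<forall>p\<in>odds_upto m. P p"
    proof
      fix p assume "p \<in> odds_upto m"
      then obtain k where "p = 2 * k + 1" "k < m"
        by (auto simp: odds_upto_def elim!: oddE)
      then show "P p"
        using bspec[OF P, of "Suc k"] by simp
    qed
  next
    assume P: "\<forall>p\<in>odds_upto m. P p"
    show "\<forall>i\<in>{1..m}. P (2 * i - 1)"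
    proof
      fix i assume "i \<in> {1..m}"
      then have "2 * i - 1 \<in> odds_upto m"
        by (auto simp: odds_upto_def)
      with P show "P (2 * i - 1)" ..
    qed
  qed
  have "{\<sigma>. dumont_permutation m \<sigma>} = {\<sigma> \<in> C. \<forall>p\<in>odds_upto m. \<not> \<sigma> p < p}"
    unfolding C_def dumont_permutation_def evens odds by (auto simp: not_less)
  then have "int (genocchi (Suc m)) =
      (\<Sum>S\<in>Pow (odds_upto m). (- 1) ^ card S * int (card {\<sigma> \<in> C. \<forall>p\<in>S. \<sigma> p < p}))"
    using \<open>finite C\<close> fin by (simp add: genocchi_def card_avoiding_inclusion_exclusion)
  \<comment> \<open>The inserted difference of \<open>gandhi 0\<close> equals 1 and brings the sum
    into the form used in the induction, with \<open>r = 0\<close>.\<close>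
  also have "\<dots> = (\<Sum>S\<in>Pow (odds_upto m). (- 1) ^ card S *
      int (card (descending_injections (S \<union> evens_upto m))) *
      (fact (m - card S) * (gandhi 0 (Suc (m - card S)) - gandhi 0 (m - card S))))"
  proof (rule sum.cong)
    fix S assume S: "S \<in> Pow (odds_upto m)"
    have Q: "S \<union> evens_upto m \<subseteq> {1..2 * m}" "S \<inter> evens_upto m = {}" "finite S"
      "finite (evens_upto m)"
      using S by (auto simp: odds_upto_def evens_upto_def intro: finite_subset)
    have "{\<sigma> \<in> C. \<forall>p\<in>S. \<sigma> p < p} =
        {\<sigma>. \<sigma> permutes {1..2 * m} \<and> (\<forall>p\<in>S \<union> evens_upto m. \<sigma> p < p)}"
      by (auto simp: C_def)
    moreover have "2 * m - card (S \<union> evens_upto m) = m - card S"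
      using Q by (simp add: card_Un_disjoint card_evens_upto)
    ultimately show "(- 1) ^ card S * int (card {\<sigma> \<in> C. \<forall>p\<in>S. \<sigma> p < p}) =
        (- 1) ^ card S * int (card (descending_injections (S \<union> evens_upto m))) *
        (fact (m - card S) * (gandhi 0 (Suc (m - card S)) - gandhi 0 (m - card S)))"
      using card_permutations_descending[OF Q(1)] by simp
  qed simp
  also have "\<dots> = gandhi m 1"
    using signed_descending_sum[of m 0] by simp
  finally show ?thesis .
qed


section \<open>Colourings of the bipartite graph of the arrangement\<close>

text \<open>The shifts act freely on \<open>C\<close> as a group of order \<open>q\<close>, since they move the value at \<open>v\<close>.\<close>

lemma dvd_card_shift_invariant:
  fixes q :: nat
  assumes q: "q > 0" and C: "C \<subseteq> Pi\<^sub>E W (\<lambda>_. {0..<int q})" and v: "v \<in> S" "S \<subseteq> W"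
    and shift: "\<And>c s. c \<in> C \<Longrightarrow> (\<lambda>w. if w \<in> S then (c w + s) mod int q else c w) \<in> C"
  shows "q dvd card C"
proof -
  define \<phi> where "\<phi> s c = (\<lambda>w. if w \<in> S then (c w + s) mod int q else c w)" for s and c :: "'a \<Rightarrow> int"
  have C': "c w mod int q = c w" "0 \<le> c w" "c w < int q" if "c \<in> C" "w \<in> S" for c w
    using that C v by (auto dest!: subsetD[of C] PiE_mem[of c W _ w])
  have "bij_betw (\<lambda>(s, c). \<phi> s c) ({0..<int q} \<times> {c \<in> C. c v = 0}) C"
  \<comment> \<open>A colouring in \<open>C\<close> corresponds to its colour at \<open>v\<close>,
    which is the shift, together with its translate having colour 0 at \<open>v\<close>.\<close>
  proof (rule bij_betw_byWitness[where f' = "\<lambda>c. (c v, \<phi> (- c v) c)"])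
    show "\<forall>p\<in>{0..<int q} \<times> {c \<in> C. c v = 0}.
        (\<lambda>c. (c v, \<phi> (- c v) c)) ((\<lambda>(s, c). \<phi> s c) p) = p"
      using v C' by (auto simp: \<phi>_def fun_eq_iff mod_simps)
    show "\<forall>c\<in>C. (\<lambda>(s, c). \<phi> s c) (c v, \<phi> (- c v) c) = c"
      using v C' by (auto simp: \<phi>_def fun_eq_iff mod_simps)
    show "(\<lambda>(s, c). \<phi> s c) ` ({0..<int q} \<times> {c \<in> C. c v = 0}) \<subseteq> C"
      using shift by (auto simp: \<phi>_def)
    show "(\<lambda>c. (c v, \<phi> (- c v) c)) ` C \<subseteq> {0..<int q} \<times> {c \<in> C. c v = 0}"
      using shift v C' by (auto simp: \<phi>_def)
  qed
  then have "card C = q * card {c \<in> C. c v = 0}"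
    by (simp add: bij_betw_same_card[symmetric] card_cartesian_product)
  then show ?thesis
    by simp
qed

text \<open>The hyperplane \<open>x\<^sub>i - x\<^sub>j = y\<^sub>i\<close> reads \<open>z\<^sub>i = x\<^sub>j\<close> for \<open>z\<^sub>i = x\<^sub>i - y\<^sub>i\<close>, so the arrangement is graphic
  for the bipartite graph with vertices \<open>Inl i\<close> (coordinate \<open>z\<^sub>i\<close>) and \<open>Inr j\<close> (coordinate \<open>x\<^sub>j\<close>).
  The coordinate \<open>x\<^sub>1\<close> occurs only inside \<open>z\<^sub>1\<close> and is not a vertex.\<close>

definition linial_vertices :: "nat \<Rightarrow> (nat + nat) set" where
  "linial_vertices n = Inl ` {1..n} \<union> Inr ` {2..n + 1}"

definition linial_edges :: "nat \<Rightarrow> (nat \<times> nat) set" where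
  "linial_edges n = {(i, j). 1 \<le> i \<and> i < j \<and> j \<le> n + 1}"

definition linial_hyperplane :: "nat \<Rightarrow> nat \<times> nat \<Rightarrow> ((nat \<Rightarrow> real) \<times> (nat \<Rightarrow> real)) set" where
  "linial_hyperplane n = (\<lambda>(i, j). {(x, y) \<in> linial_space n. x i - x j = y i})"

text \<open>The colour type is left open: real colourings describe points of flats, integer ones are
  counted modulo \<open>q\<close>.\<close>

abbreviation monochromatic :: "(nat + nat \<Rightarrow> 'a) \<Rightarrow> nat \<times> nat \<Rightarrow> bool" where
  "monochromatic c e \<equiv> c (Inl (fst e)) = c (Inr (snd e))"

text \<open>Fixing the root colour removes the global shift, so a connected spanning subgraph has a
  single monochromatic colouring.\<close>

definition rooted_colourings :: "nat \<Rightarrow> nat \<Rightarrow> (nat + nat \<Rightarrow> int) set" where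
  "rooted_colourings n q =
    {c \<in> Pi\<^sub>E (linial_vertices n) (\<lambda>_. {0..<int q}). c (Inl 1) = 0}"

lemma finite_linial_edges: "finite (linial_edges n)"
  by (rule finite_subset[of _ "{..n + 1} \<times> {..n + 1}"]) (auto simp: linial_edges_def)

lemma finite_rooted_colourings: "finite (rooted_colourings n q)"
proof -
  have "finite (Pi\<^sub>E (linial_vertices n) (\<lambda>_. {0..<int q}))"
    by (intro finite_PiE) (auto simp: linial_vertices_def)
  then show ?thesis
    by (rule rev_finite_subset) (auto simp: rooted_colourings_def)
qed

lemma homogenized_linial_eq: "homogenized_linial n = linial_hyperplane n ` linial_edges n"
  by (force simp: homogenized_linial_def linial_hyperplane_def linial_edges_def)

section \<open>Flats compared with monochromatic colourings\<close>

text \<open>The graph is connected: \<open>Inl 1\<close> is adjacent to every \<open>Inr j\<close>,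
  and \<open>Inr (n + 1)\<close> to every \<open>Inl i\<close>.\<close>

lemma monochromatic_imp_constant:
  assumes "n \<ge> 1" "\<And>e. e \<in> linial_edges n \<Longrightarrow> monochromatic c e" "v \<in> linial_vertices n"
  shows "c v = c (Inl 1)"
proof -
  have right: "c (Inr j) = c (Inl 1)" if "j \<in> {2..n + 1}" for j
    using assms(2)[of "(1, j)"] that by (auto simp: linial_edges_def)
  have left: "c (Inl i) = c (Inl 1)" if "i \<in> {1..n}" for i
  proof -
    have "c (Inl i) = c (Inr (n + 1))"
      using assms(2)[of "(i, n + 1)"] that by (simp add: linial_edges_def)
    also have "\<dots> = c (Inl 1)"
      using right[of "n + 1"] \<open>n \<ge> 1\<close> by simp
    finally show ?thesis .
  qed
  show ?thesis
    using assms(3) unfolding linial_vertices_def by (blast intro: left right)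
qed

lemma mem_linial_flat_iff:
  assumes "B \<subseteq> linial_edges n"
  shows "(x, y) \<in> linial_space n \<inter> \<Inter>(linial_hyperplane n ` B) \<longleftrightarrow>
    (x, y) \<in> linial_space n \<and> (\<forall>e\<in>B. monochromatic (case_sum (\<lambda>i. x i - y i) x) e)"
  by (auto simp: linial_hyperplane_def)

text \<open>If \<open>B\<close> cuts out the top flat, the root colour 0 propagates to all vertices.
  Otherwise some point of its flat separates vertices from the root, and shifting their colours
  makes the count divisible by \<open>q\<close>.\<close>

lemma card_monochromatic_cong:
  assumes n: "n \<ge> 1" and q: "q > 0" and B: "B \<subseteq> linial_edges n"
  shows "[int (card {c \<in> rooted_colourings n q. \<forall>e\<in>B. monochromatic c e}) =
    (if linial_space n \<inter> \<Inter>(linial_hyperplane n ` B) =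
        linial_space n \<inter> \<Inter>(linial_hyperplane n ` linial_edges n) then 1 else 0)] (mod int q)"
    (is "[int (card ?C) = (if ?flat B = ?flat _ then 1 else 0)] (mod _)")
proof (cases "?flat B = ?flat (linial_edges n)")
  case True
  have "c = restrict (\<lambda>_. 0) (linial_vertices n)" if c: "c \<in> ?C" for c
  proof -
    \<comment> \<open>The colouring is turned into a point of the space. The coordinate
      \<open>x 1\<close> belongs to no vertex and is set to 0; \<open>y\<close> is chosen so that
      \<open>x i - y i\<close> is the colour of \<open>Inl i\<close>.\<close>
    define x where "x = restrict (\<lambda>j. if j = 1 then 0 else real_of_int (c (Inr j))) {1..n + 1}"
    define y where "y = restrict (\<lambda>i. x i - real_of_int (c (Inl i))) {1..n}"
    have c': "case_sum (\<lambda>i. x i - y i) x v = real_of_int (c v)" if "v \<in> linial_vertices n" for v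
      using that by (auto simp: x_def y_def linial_vertices_def)
    have iff: "monochromatic (case_sum (\<lambda>i. x i - y i) x) e \<longleftrightarrow> monochromatic c e"
      if "e \<in> linial_edges n" for e
    proof -
      have "Inl (fst e) \<in> linial_vertices n" "Inr (snd e) \<in> linial_vertices n"
        using that by (auto simp: linial_edges_def linial_vertices_def)
      then show ?thesis
        by (simp only: c' of_int_eq_iff)
    qed
    have "(x, y) \<in> linial_space n"
      by (auto simp: linial_space_def x_def y_def)
    then have "(x, y) \<in> ?flat B"
      using c B iff unfolding mem_linial_flat_iff[OF B] by blast
    then have "(x, y) \<in> ?flat (linial_edges n)"
      by (simp only: True)
    then have "monochromatic c e" if "e \<in> linial_edges n" for e
      using that iff unfolding mem_linial_flat_iff[OF order.refl] by blast
    note const_c = monochromatic_imp_constant[of n c, OF n this]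
    have "c v = 0" if "v \<in> linial_vertices n" for v
      using const_c[OF _ that] c by (simp add: rooted_colourings_def)
    then show ?thesis
      using c by (auto simp: rooted_colourings_def fun_eq_iff PiE_iff extensional_def)
  qed
  moreover have "restrict (\<lambda>_. 0) (linial_vertices n) \<in> ?C"
  proof -
    have "Inl 1 \<in> linial_vertices n"
      using n by (auto simp: linial_vertices_def)
    moreover have "Inl (fst e) \<in> linial_vertices n" "Inr (snd e) \<in> linial_vertices n" if "e \<in> B" for e
      using that B by (auto simp: linial_edges_def linial_vertices_def)
    ultimately show ?thesis
      using q by (auto simp: rooted_colourings_def)
  qed
  ultimately have "?C = {restrict (\<lambda>_. 0) (linial_vertices n)}"
    by blast
  then show ?thesis
    using True by simp
next
  case False
  have "?flat (linial_edges n) \<subseteq> ?flat B"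
    using B by auto
  with False obtain x y where xy: "(x, y) \<in> ?flat B" "(x, y) \<notin> ?flat (linial_edges n)"
    by auto
  define f where "f = case_sum (\<lambda>i. x i - y i) x"
  \<comment> \<open>Since \<open>f\<close> is constant along the edges in \<open>B\<close>, no such
    edge leaves \<open>S\<close>, so a shift on \<open>S\<close> keeps them monochromatic. The root
    is not in \<open>S\<close> and keeps its colour.\<close>
  define S where "S = {v \<in> linial_vertices n. f v \<noteq> f (Inl 1)}"
  have fB: "\<forall>e\<in>B. monochromatic f e" and "\<not> (\<forall>e\<in>linial_edges n. monochromatic f e)"
    using xy unfolding mem_linial_flat_iff[OF B] mem_linial_flat_iff[OF order.refl] f_def by auto
  then obtain e where e: "e \<in> linial_edges n" "\<not> monochromatic f e"
    by blast
  then have "Inl (fst e) \<in> linial_vertices n" "Inr (snd e) \<in> linial_vertices n"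
    by (auto simp: linial_edges_def linial_vertices_def)
  then obtain v where v: "v \<in> S"
    using e(2) unfolding S_def by (metis (mono_tags, lifting) mem_Collect_eq)
  have "q dvd card ?C"
  proof (rule dvd_card_shift_invariant[OF q _ v])
    show "?C \<subseteq> Pi\<^sub>E (linial_vertices n) (\<lambda>_. {0..<int q})"
      by (auto simp: rooted_colourings_def)
    show "S \<subseteq> linial_vertices n"
      by (auto simp: S_def)
  next
    fix c s assume c: "c \<in> ?C"
    let ?c = "\<lambda>w. if w \<in> S then (c w + s) mod int q else c w"
    have "?c \<in> rooted_colourings n q"
      using c q by (auto simp: rooted_colourings_def S_def PiE_iff extensional_def)
    moreover have "monochromatic ?c e" if "e \<in> B" for e
    proof -
      have "Inl (fst e) \<in> linial_vertices n" "Inr (snd e) \<in> linial_vertices n"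
        using that B by (auto simp: linial_edges_def linial_vertices_def)
      then have "Inl (fst e) \<in> S \<longleftrightarrow> Inr (snd e) \<in> S"
        using fB that by (simp add: S_def)
      then show ?thesis
        using c that by simp
    qed
    ultimately show "?c \<in> ?C"
      by blast
  qed
  then show ?thesis
    using False by (simp add: cong_0_iff)
qed

section \<open>Proper colourings and the Gandhi recursion\<close>

text \<open>These are the colours of the vertices \<open>Inl i\<close>, that is, of the
  \<open>z\<^sub>i\<close>, with the root colour fixed.\<close>

definition rooted_tuples :: "nat \<Rightarrow> nat \<Rightarrow> (nat \<Rightarrow> int) set" where
  "rooted_tuples n q = Pi\<^sub>E {1..n} (\<lambda>i. if i = 1 then {0} else {0..<int q})"

lemma finite_rooted_tuples: "finite (rooted_tuples n q)"
  unfolding rooted_tuples_def by (intro finite_PiE) auto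

lemma rooted_tuples_image:
  assumes "z \<in> rooted_tuples n q" "q > 0" "i \<le> n"
  shows "z ` {1..i} \<subseteq> {0..<int q}"
proof -
  have "z k \<in> {0..<int q}" if "k \<in> {1..i}" for k
    using assms that PiE_mem[of z "{1..n}" "\<lambda>i. if i = 1 then {0} else {0..<int q}" k]
    by (auto simp: rooted_tuples_def split: if_splits)
  then show ?thesis
    by blast
qed

lemma sum_rooted_tuples_Suc:
  assumes "n \<ge> 1"
  shows "(\<Sum>z\<in>rooted_tuples (Suc n) q. g z) =
    (\<Sum>z\<in>rooted_tuples n q. \<Sum>t\<in>{0..<int q}. g (z(Suc n := t)))"
proof -
  have "rooted_tuples (Suc n) q =
      (\<lambda>(t, z). z(Suc n := t)) ` ({0..<int q} \<times> rooted_tuples n q)"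
    using assms by (simp add: rooted_tuples_def atLeastAtMostSuc_conv PiE_insert_eq)
  moreover have "inj_on (\<lambda>(t, z). z(Suc n := t)) ({0..<int q} \<times> rooted_tuples n q)"
    using assms inj_combinator[of "Suc n" "{1..n}" "\<lambda>i. if i = 1 then {0} else {0..<int q}"]
    by (simp add: rooted_tuples_def)
  ultimately have "(\<Sum>z\<in>rooted_tuples (Suc n) q. g z) =
      (\<Sum>(t, z)\<in>{0..<int q} \<times> rooted_tuples n q. g (z(Suc n := t)))"
    by (simp add: sum.reindex case_prod_unfold)
  then show ?thesis
    by (simp add: sum.cartesian_product[symmetric] sum.swap[of _ "rooted_tuples n q"])
qed

text \<open>The last colour is summed out. If \<open>k\<close> colours occur before it,
  \<open>k\<close> choices repeat one and \<open>q - k\<close> are new; together with the factor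
  \<open>- k\<close> this is congruent to \<open>gandhi (Suc r) k\<close>.\<close>

lemma rooted_tuples_gandhi_sum_cong:
  assumes "n \<ge> 1" "q > 0"
  shows "[(\<Sum>z\<in>rooted_tuples n q. (\<Prod>i\<in>{1..<n}. - int (card (z ` {1..i}))) *
      gandhi r (card (z ` {1..n}))) = gandhi (n - 1 + r) 1] (mod int q)"
  using assms(1)
proof (induction n arbitrary: r rule: dec_induct)
  case base
  have "rooted_tuples 1 q = {(\<lambda>_. undefined)(1 := 0)}"
    by (simp add: rooted_tuples_def PiE_singleton[symmetric] PiE_insert_eq)
  then show ?case
    by simp
next
  case (step n)
  have "(\<Sum>t\<in>{0..<int q}. (\<Prod>i\<in>{1..<Suc n}. - int (card ((z(Suc n := t)) ` {1..i}))) *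
        gandhi r (card ((z(Suc n := t)) ` {1..Suc n}))) =
      (\<Prod>i\<in>{1..<n}. - int (card (z ` {1..i}))) *
        (let k = card (z ` {1..n}) in
          - int k * (int k * gandhi r k + (int q - int k) * gandhi r (Suc k)))"
    if z: "z \<in> rooted_tuples n q" for z
  proof -
    let ?K = "z ` {1..n}"
    have upd: "(z(Suc n := t)) ` {1..i} = z ` {1..i}" if "i \<le> n" for i t
      using that by auto
    have upd': "(z(Suc n := t)) ` {1..Suc n} = insert t ?K" for t
      using upd[of n t] atLeastAtMostSuc_conv[of 1 n] by (simp only: image_insert fun_upd_same)
    have K: "?K \<subseteq> {0..<int q}"
      using rooted_tuples_image[OF z \<open>q > 0\<close>] by simp
    have "(\<Sum>t\<in>{0..<int q}. gandhi r (card (insert t ?K))) =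
        (\<Sum>t\<in>?K. gandhi r (card (insert t ?K))) + (\<Sum>t\<in>{0..<int q} - ?K. gandhi r (card (insert t ?K)))"
      using K by (subst add.commute, subst sum.subset_diff[of ?K]) auto
    also have "(\<Sum>t\<in>?K. gandhi r (card (insert t ?K))) = (\<Sum>t\<in>?K. gandhi r (card ?K))"
      by (intro sum.cong) (simp_all add: insert_absorb)
    also have "(\<Sum>t\<in>{0..<int q} - ?K. gandhi r (card (insert t ?K))) =
        (\<Sum>t\<in>{0..<int q} - ?K. gandhi r (Suc (card ?K)))"
      by (intro sum.cong) auto
    also have "(\<Sum>t\<in>?K. gandhi r (card ?K)) + (\<Sum>t\<in>{0..<int q} - ?K. gandhi r (Suc (card ?K))) =
        int (card ?K) * gandhi r (card ?K) + (int q - int (card ?K)) * gandhi r (Suc (card ?K))"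
      using K card_mono[OF _ K] by (simp add: card_Diff_subset of_nat_diff)
    finally have "(\<Sum>t\<in>{0..<int q}. gandhi r (card (insert t ?K))) = \<dots>" .
    moreover have "(\<Prod>i\<in>{1..<Suc n}. - int (card ((z(Suc n := t)) ` {1..i}))) =
        (\<Prod>i\<in>{1..<n}. - int (card (z ` {1..i}))) * - int (card ?K)" for t
    proof -
      have "(\<Prod>i\<in>{1..<Suc n}. - int (card ((z(Suc n := t)) ` {1..i}))) =
          (\<Prod>i\<in>{1..<Suc n}. - int (card (z ` {1..i})))"
        by (intro prod.cong refl arg_cong[of _ _ "\<lambda>A. - int (card A)"] upd) simp
      then show ?thesis
        using \<open>1 \<le> n\<close> by (simp add: prod.atLeastLessThan_Suc)
    qed
    ultimately show ?thesis
      by (simp only: upd' Let_def sum_distrib_left[symmetric] mult.assoc)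
  qed
  then have eq: "(\<Sum>z\<in>rooted_tuples (Suc n) q. (\<Prod>i\<in>{1..<Suc n}. - int (card (z ` {1..i}))) *
      gandhi r (card (z ` {1..Suc n}))) =
    (\<Sum>z\<in>rooted_tuples n q. (\<Prod>i\<in>{1..<n}. - int (card (z ` {1..i}))) *
        (let k = card (z ` {1..n}) in
          - int k * (int k * gandhi r k + (int q - int k) * gandhi r (Suc k))))"
    using step.hyps by (simp add: sum_rooted_tuples_Suc)
  have "[(\<Sum>z\<in>rooted_tuples n q. (\<Prod>i\<in>{1..<n}. - int (card (z ` {1..i}))) *
        (let k = card (z ` {1..n}) in
          - int k * (int k * gandhi r k + (int q - int k) * gandhi r (Suc k)))) =
    (\<Sum>z\<in>rooted_tuples n q. (\<Prod>i\<in>{1..<n}. - int (card (z ` {1..i}))) *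
      gandhi (Suc r) (card (z ` {1..n})))] (mod int q)"
  proof (intro cong_sum cong_mult cong_refl)
    fix z :: "nat \<Rightarrow> int"
    show "[(let k = card (z ` {1..n}) in
          - int k * (int k * gandhi r k + (int q - int k) * gandhi r (Suc k))) =
        gandhi (Suc r) (card (z ` {1..n}))] (mod int q)"
      by (simp add: Let_def cong_iff_dvd_diff algebra_simps power2_eq_square)
  qed
  from cong_trans[OF this step.IH[of "Suc r"]] show ?case
    unfolding eq using step.hyps by (simp del: gandhi.simps)
qed

text \<open>Once the colours \<open>z\<close> of the vertices \<open>Inl i\<close> are chosen, the
  vertices \<open>Inr j\<close> are coloured independently, each avoiding \<open>z 1\<close> up to
  \<open>z (j - 1)\<close>.\<close>

lemma card_proper_colourings:
  assumes n: "n \<ge> 1" and q: "q > 0"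
  shows "card {c \<in> rooted_colourings n q. \<forall>e\<in>linial_edges n. \<not> monochromatic c e} =
    (\<Sum>z\<in>rooted_tuples n q. \<Prod>i\<in>{1..n}. q - card (z ` {1..i}))"
proof -
  let ?P = "{c \<in> rooted_colourings n q. \<forall>e\<in>linial_edges n. \<not> monochromatic c e}"
  define X where "X z = Pi\<^sub>E {2..n + 1} (\<lambda>j. {0..<int q} - z ` {1..<j})" for z :: "nat \<Rightarrow> int"
  have "bij_betw (\<lambda>(z, x). case_sum z x) (SIGMA z:rooted_tuples n q. X z) ?P"
  proof (rule bij_betw_byWitness[where f' = "\<lambda>c. (c \<circ> Inl, c \<circ> Inr)"])
    show "\<forall>p\<in>SIGMA z:rooted_tuples n q. X z.
        (\<lambda>c. (c \<circ> Inl, c \<circ> Inr)) ((\<lambda>(z, x). case_sum z x) p) = p"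
      by (auto simp: fun_eq_iff)
    show "\<forall>c\<in>?P. (\<lambda>(z, x). case_sum z x) (c \<circ> Inl, c \<circ> Inr) = c"
      by (auto simp: fun_eq_iff split: sum.splits)
    show "(\<lambda>(z, x). case_sum z x) ` (SIGMA z:rooted_tuples n q. X z) \<subseteq> ?P"
    proof clarify
      fix z x assume z: "z \<in> rooted_tuples n q" and x: "x \<in> X z"
      have z_mem: "z i \<in> {0..<int q}" if "i \<in> {1..n}" for i
        using rooted_tuples_image[OF z q order.refl] that by blast
      have x_mem: "x j \<in> {0..<int q} - z ` {1..<j}" if "j \<in> {2..n + 1}" for j
        using x that PiE_mem[of x "{2..n + 1}" "\<lambda>j. {0..<int q} - z ` {1..<j}" j]
        by (simp add: X_def)
      have "case_sum z x v \<in> {0..<int q}" if "v \<in> linial_vertices n" for v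
        using that z_mem x_mem by (cases v) (auto simp: linial_vertices_def simp del: atLeastLessThan_iff)
      moreover have "case_sum z x v = undefined" if "v \<notin> linial_vertices n" for v
        using that z x
        by (cases v)
           (auto simp: linial_vertices_def rooted_tuples_def X_def PiE_iff extensional_def image_iff)
      moreover have "z 1 = 0"
        using z n PiE_mem[of z "{1..n}" "\<lambda>i. if i = 1 then {0} else {0..<int q}" 1]
        by (simp add: rooted_tuples_def)
      moreover have "z i \<noteq> x j" if "1 \<le> i" "i < j" "j \<le> n + 1" for i j
      proof
        assume "z i = x j"
        moreover have "z i \<in> z ` {1..<j}"
          using that by (intro imageI) simp
        ultimately show False
          using x_mem[of j] that by simp
      qed
      ultimately show "case_sum z x \<in> rooted_colourings n q \<and>
          (\<forall>e\<in>linial_edges n. \<not> monochromatic (case_sum z x) e)"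
        by (auto simp: rooted_colourings_def linial_edges_def PiE_iff extensional_def
              simp del: atLeastLessThan_iff)
    qed
    show "(\<lambda>c. (c \<circ> Inl, c \<circ> Inr)) ` ?P \<subseteq> (SIGMA z:rooted_tuples n q. X z)"
    proof (rule image_subsetI)
      fix c assume "c \<in> ?P"
      then have c_PiE: "c \<in> Pi\<^sub>E (linial_vertices n) (\<lambda>_. {0..<int q})" "c (Inl 1) = 0"
        and proper: "\<forall>e\<in>linial_edges n. \<not> monochromatic c e"
        by (auto simp: rooted_colourings_def)
      have "c (Inl i) \<in> {0..<int q}" if "i \<in> {1..n}" for i
        using that by (intro PiE_mem[OF c_PiE(1)]) (simp add: linial_vertices_def)
      moreover have "c (Inl i) = undefined" if "i \<notin> {1..n}" for i
        using that by (intro PiE_arb[OF c_PiE(1)]) (auto simp: linial_vertices_def)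
      ultimately have "c \<circ> Inl \<in> rooted_tuples n q"
        unfolding rooted_tuples_def using c_PiE(2) by (intro PiE_I) auto
      moreover have "c \<circ> Inr \<in> X (c \<circ> Inl)"
        unfolding X_def
      proof (intro PiE_I)
        fix j assume j: "j \<in> {2..n + 1}"
        have "c (Inr j) \<in> {0..<int q}"
          using j by (intro PiE_mem[OF c_PiE(1)]) (simp add: linial_vertices_def)
        moreover have "c (Inr j) \<notin> (c \<circ> Inl) ` {1..<j}"
        proof
          assume "c (Inr j) \<in> (c \<circ> Inl) ` {1..<j}"
          then obtain i where "i \<in> {1..<j}" "c (Inr j) = c (Inl i)"
            by (elim imageE) simp
          then show False
            using bspec[OF proper, of "(i, j)"] j by (simp add: linial_edges_def)
        qed
        ultimately show "(c \<circ> Inr) j \<in> {0..<int q} - (c \<circ> Inl) ` {1..<j}"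
          by simp
      next
        fix j assume "j \<notin> {2..n + 1}"
        then show "(c \<circ> Inr) j = undefined"
          unfolding comp_apply by (intro PiE_arb[OF c_PiE(1)]) (auto simp: linial_vertices_def)
      qed
      ultimately show "(c \<circ> Inl, c \<circ> Inr) \<in> (SIGMA z:rooted_tuples n q. X z)"
        by blast
    qed
  qed
  then have "card ?P = card (SIGMA z:rooted_tuples n q. X z)"
    by (rule bij_betw_same_card[symmetric])
  also have "\<dots> = (\<Sum>z\<in>rooted_tuples n q. card (X z))"
  proof (rule card_SigmaI)
    show "\<forall>z\<in>rooted_tuples n q. finite (X z)"
      unfolding X_def by (intro ballI finite_PiE) auto
  qed (rule finite_rooted_tuples)
  also have "\<dots> = (\<Sum>z\<in>rooted_tuples n q. \<Prod>i\<in>{1..n}. q - card (z ` {1..i}))"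
  proof (rule sum.cong)
    fix z assume z: "z \<in> rooted_tuples n q"
    have "card (X z) = (\<Prod>j\<in>{2..n + 1}. card ({0..<int q} - z ` {1..<j}))"
      by (simp add: X_def card_PiE)
    \<comment> \<open>The substitution is \<open>i = j - 1\<close>.\<close>
    also have "\<dots> = (\<Prod>i\<in>{1..n}. card ({0..<int q} - z ` {1..i}))"
      by (rule prod.reindex_bij_witness[of _ Suc "\<lambda>j. j - 1"])
         (auto simp: atLeastLessThanSuc_atLeastAtMost[symmetric])
    also have "\<dots> = (\<Prod>i\<in>{1..n}. q - card (z ` {1..i}))"
      using rooted_tuples_image[OF z q] by (intro prod.cong) (auto simp: card_Diff_subset)
    finally show "card (X z) = (\<Prod>i\<in>{1..n}. q - card (z ` {1..i}))" .
  qed simp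
  finally show ?thesis .
qed

lemma card_proper_colourings_cong:
  assumes n: "n \<ge> 1" and q: "q > 0"
  shows "[int (card {c \<in> rooted_colourings n q. \<forall>e\<in>linial_edges n. \<not> monochromatic c e}) =
    - gandhi (n - 1) 1] (mod int q)"
proof -
  have "int (card {c \<in> rooted_colourings n q. \<forall>e\<in>linial_edges n. \<not> monochromatic c e}) =
      (\<Sum>z\<in>rooted_tuples n q. \<Prod>i\<in>{1..n}. int (q - card (z ` {1..i})))"
    using assms by (simp add: card_proper_colourings)
  also have "[\<dots> = (\<Sum>z\<in>rooted_tuples n q. \<Prod>i\<in>{1..n}. - int (card (z ` {1..i})))] (mod int q)"
  proof (intro cong_sum cong_prod)
    fix z i assume z: "z \<in> rooted_tuples n q" and i: "i \<in> {1..n}"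
    have "card (z ` {1..i}) \<le> q"
      using card_mono[OF _ rooted_tuples_image[OF z q, of i]] i by simp
    then show "[int (q - card (z ` {1..i})) = - int (card (z ` {1..i}))] (mod int q)"
      by (simp add: cong_iff_dvd_diff of_nat_diff)
  qed
  \<comment> \<open>The factor for \<open>i = n\<close> is split off; it equals
    \<open>- gandhi 0 k\<close> for the number \<open>k\<close> of colours used.\<close>
  also have "(\<Sum>z\<in>rooted_tuples n q. \<Prod>i\<in>{1..n}. - int (card (z ` {1..i}))) =
      - (\<Sum>z\<in>rooted_tuples n q. (\<Prod>i\<in>{1..<n}. - int (card (z ` {1..i}))) *
          gandhi 0 (card (z ` {1..n})))"
    using n by (simp add: prod.last_plus sum_negf mult.commute)
  also have "[\<dots> = - gandhi (n - 1 + 0) 1] (mod int q)"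
    using rooted_tuples_gandhi_sum_cong[OF n q, of 0] by (rule cong_uminus)
  finally show ?thesis
    by simp
qed

section \<open>The Moebius invariant modulo every \<open>q\<close>\<close>

lemma mobius_linial_lattice:
  "mobius (linial_lattice n) \<bottom>\<^bsub>linial_lattice n\<^esub> \<top>\<^bsub>linial_lattice n\<^esub> =
    (\<Sum>B | B \<subseteq> linial_edges n \<and> linial_space n \<inter> \<Inter>(linial_hyperplane n ` B) =
        linial_space n \<inter> \<Inter>(linial_hyperplane n ` linial_edges n). (- 1) ^ card B)"
proof -
  have "\<not> linial_space n \<subseteq> linial_hyperplane n e" if "e \<in> linial_edges n" for e
  proof -
    obtain i j where "e = (i, j)"
      by fastforce
    with that have e: "e = (i, j)" "1 \<le> i" "i < j" "j \<le> n + 1"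
      by (simp_all add: linial_edges_def)
    \<comment> \<open>At \<open>x = 0\<close>, \<open>y = 1\<close> every equation reads
      \<open>0 = 1\<close>, so this point lies on no hyperplane.\<close>
    let ?p = "(restrict (\<lambda>_. 0) {1..n + 1}, restrict (\<lambda>_. 1) {1..n}) :: (nat \<Rightarrow> real) \<times> (nat \<Rightarrow> real)"
    have "?p \<in> linial_space n" "?p \<notin> linial_hyperplane n e"
      using e by (auto simp: linial_space_def linial_hyperplane_def)
    then show ?thesis
      by blast
  qed
  moreover have "linial_space n \<inter> \<Inter>(linial_hyperplane n ` linial_edges n) \<in>
      carrier (intersection_lattice (linial_space n) (linial_hyperplane n ` linial_edges n))"
    by (auto simp: intersection_lattice_def)
  ultimately show ?thesis
    unfolding linial_lattice_def homogenized_linial_eq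
      bottom_intersection_lattice top_intersection_lattice
    by (intro mobius_intersection_lattice finite_linial_edges)
qed

text \<open>The indicator that \<open>B\<close> cuts out the top is replaced, modulo
  \<open>q\<close>, by its number of monochromatic rooted colourings. Inclusion-exclusion then turns
  the signed sum into the count of proper colourings.\<close>

lemma mobius_linial_lattice_cong:
  assumes n: "n \<ge> 1" and q: "q > 0"
  shows "[mobius (linial_lattice n) \<bottom>\<^bsub>linial_lattice n\<^esub> \<top>\<^bsub>linial_lattice n\<^esub> = - gandhi (n - 1) 1]
    (mod int q)"
proof -
  let ?flat = "\<lambda>B. linial_space n \<inter> \<Inter>(linial_hyperplane n ` B)"
  have "mobius (linial_lattice n) \<bottom>\<^bsub>linial_lattice n\<^esub> \<top>\<^bsub>linial_lattice n\<^esub> =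
      (\<Sum>B\<in>Pow (linial_edges n). (- 1) ^ card B *
        (if ?flat B = ?flat (linial_edges n) then 1 else 0))"
    unfolding mobius_linial_lattice
    by (rule sum.mono_neutral_cong_left) (auto simp: finite_linial_edges)
  also have "[\<dots> = (\<Sum>B\<in>Pow (linial_edges n). (- 1) ^ card B *
      int (card {c \<in> rooted_colourings n q. \<forall>e\<in>B. monochromatic c e}))] (mod int q)"
    by (intro cong_sum cong_mult cong_refl cong_sym[OF card_monochromatic_cong] n q) auto
  also have "(\<Sum>B\<in>Pow (linial_edges n). (- 1) ^ card B *
      int (card {c \<in> rooted_colourings n q. \<forall>e\<in>B. monochromatic c e})) =
      int (card {c \<in> rooted_colourings n q. \<forall>e\<in>linial_edges n. \<not> monochromatic c e})"
    using card_avoiding_inclusion_exclusion[OF finite_rooted_colourings finite_linial_edges,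
        where R = "\<lambda>c e. monochromatic c e"] by (rule sym)
  also have "[\<dots> = - gandhi (n - 1) 1] (mod int q)"
    by (rule card_proper_colourings_cong[OF n q])
  finally show ?thesis .
qed

theorem corollary3p9:
  fixes n :: nat
  assumes "n \<ge> 1"
  shows "mobius (linial_lattice n) \<bottom>\<^bsub>linial_lattice n\<^esub> \<top>\<^bsub>linial_lattice n\<^esub> = - int (genocchi n)"
proof -
  let ?\<mu> = "mobius (linial_lattice n) \<bottom>\<^bsub>linial_lattice n\<^esub> \<top>\<^bsub>linial_lattice n\<^esub>"
  define d where "d = ?\<mu> - - gandhi (n - 1) 1"
  \<comment> \<open>The modulus \<open>\<bar>d\<bar> + 1\<close> exceeds
    \<open>\<bar>d\<bar>\<close>, so divisibility forces \<open>d = 0\<close>.\<close>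
  have "int (Suc (nat \<bar>d\<bar>)) dvd d"
    using mobius_linial_lattice_cong[OF assms, of "Suc (nat \<bar>d\<bar>)"]
    by (simp only: cong_iff_dvd_diff zero_less_Suc d_def)
  then have "d = 0"
    using dvd_imp_le_int[of d "int (Suc (nat \<bar>d\<bar>))"] by fastforce
  then show ?thesis
    using genocchi_eq_gandhi[of "n - 1"] assms by (simp add: d_def)
qed

end
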